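(* Let $a\geq 2$ be an integer. There exists $x\in[0,1]$ such that $c_{a,n}(x)=n+1$ for all $n\in\mathbb{N}$ (minimal complexity in base $a$ among irrational numbers), and $c_{b,n}(x)=b^n$ for all $n\in\mathbb{N}$ and every integer $b\geq 2$ that is multiplicatively independent of $a$ (maximal complexity in base $b$).
   Context: For an integer $a\geq 2$, $n\in\mathbb{N}=\{1,2,\ldots\}$ and $x\in[0,1]$, the base-$a$ complexity $c_{a,n}(x)$ is the number of distinct words $w\in\{0,\ldots,a-1\}^n$ that appear as blocks of consecutive digits in the base-$a$ expansion of $x$ (this expansion is unique for irrational $x$). Every irrational $x$ satisfies $c_{a,n}(x)\geq n+1$ for all $n$. Integers $a,b\geq 2$ are multiplicatively independent if $a^m\neq b^n$ for all positive integers $m,n$. *)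

theory Defs
  imports Complex_Main
begin

definition is_base_expansion :: "nat \<Rightarrow> real \<Rightarrow> (nat \<Rightarrow> nat) \<Rightarrow> bool" where
  "is_base_expansion a x d \<longleftrightarrow> (\<forall>i. d i < a) \<and> (\<lambda>i. real (d i) / real a ^ Suc i) sums x"

text \<open>
  Digits are indexed from 0, so digit \<open>i\<close> has weight \<open>a ^ -(i + 1)\<close>. For irrational \<open>x\<close> in
  \<open>[0,1]\<close> these are the digits of the unique base-\<open>a\<close> expansion (see
  \<open>is_base_expansion_iff_base_digit\<close> below). For rational \<open>x\<close> in \<open>[0,1)\<close> with two expansions,
  the terminating one is chosen; the point \<open>1\<close> is treated like \<open>0\<close>.
\<close>
definition base_digit :: "nat \<Rightarrow> real \<Rightarrow> nat \<Rightarrow> nat" where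
  "base_digit a x i = nat \<lfloor>real a ^ Suc i * x\<rfloor> mod a"

definition base_words :: "nat \<Rightarrow> nat \<Rightarrow> real \<Rightarrow> nat list set" where
  "base_words a n x =
     {w. length w = n \<and> set w \<subseteq> {..<a} \<and> (\<exists>k. \<forall>i<n. w ! i = base_digit a x (k + i))}"

definition base_complexity :: "nat \<Rightarrow> nat \<Rightarrow> real \<Rightarrow> nat" where
  "base_complexity a n x = card (base_words a n x)"

definition mult_independent :: "nat \<Rightarrow> nat \<Rightarrow> bool" where
  "mult_independent a b \<longleftrightarrow> (\<forall>m>0. \<forall>n>0. a ^ m \<noteq> b ^ n)"

lemma is_base_expansion_base_digit:
  assumes a: "a \<ge> 2" and x: "0 \<le> x" "x < 1"
  shows "is_base_expansion a x (base_digit a x)"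
proof -
  have part: "(\<Sum>i<n. real (base_digit a x i) / real a ^ Suc i) = of_int \<lfloor>real a ^ n * x\<rfloor> / real a ^ n" for n
  proof (induction n)
    case 0
    then show ?case using x by (simp add: floor_eq_iff)
  next
    case (Suc n)
    define y where "y = real a ^ n * x"
    have y: "y \<ge> 0" using x by (simp add: y_def)
    have "\<lfloor>real a * y\<rfloor> div int a = \<lfloor>y\<rfloor>"
      using floor_divide_real_eq_div[of "int a" "real a * y"] a by simp
    hence "\<lfloor>real a * y\<rfloor> = int a * \<lfloor>y\<rfloor> + \<lfloor>real a * y\<rfloor> mod int a"
      by (metis mult_div_mod_eq)
    moreover have "int (base_digit a x n) = \<lfloor>real a * y\<rfloor> mod int a"
      using y by (simp add: base_digit_def y_def zmod_int mult.assoc)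
    ultimately have *: "\<lfloor>real a * y\<rfloor> = int a * \<lfloor>y\<rfloor> + int (base_digit a x n)"
      by simp
    have "real_of_int \<lfloor>real a * y\<rfloor> = real a * of_int \<lfloor>y\<rfloor> + real (base_digit a x n)"
      unfolding * by simp
    thus ?case using Suc a by (simp add: y_def mult.assoc field_simps)
  qed
  have "(\<lambda>n. of_int \<lfloor>real a ^ n * x\<rfloor> / real a ^ n) \<longlonglongrightarrow> x"
  proof (rule real_tendsto_sandwich)
    show "\<forall>\<^sub>F n in sequentially. x - (1 / real a) ^ n \<le> of_int \<lfloor>real a ^ n * x\<rfloor> / real a ^ n"
    proof (rule always_eventually, rule allI)
      fix n
      have "(real a ^ n * x - 1) / real a ^ n \<le> of_int \<lfloor>real a ^ n * x\<rfloor> / real a ^ n"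
        by (rule divide_right_mono) (linarith, simp)
      moreover have "(real a ^ n * x - 1) / real a ^ n = x - (1 / real a) ^ n"
        using a by (simp add: diff_divide_distrib power_one_over)
      ultimately show "x - (1 / real a) ^ n \<le> of_int \<lfloor>real a ^ n * x\<rfloor> / real a ^ n"
        by simp
    qed
    show "\<forall>\<^sub>F n in sequentially. of_int \<lfloor>real a ^ n * x\<rfloor> / real a ^ n \<le> x"
    proof (rule always_eventually, rule allI)
      fix n
      have "of_int \<lfloor>real a ^ n * x\<rfloor> \<le> real a ^ n * x" by linarith
      thus "of_int \<lfloor>real a ^ n * x\<rfloor> / real a ^ n \<le> x"
        using a by (simp add: field_simps)
    qed
    have "(\<lambda>n. (1 / real a) ^ n) \<longlonglongrightarrow> 0" using a by (intro LIMSEQ_power_zero) simp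
    thus "(\<lambda>n. x - (1 / real a) ^ n) \<longlonglongrightarrow> x" using tendsto_diff[OF tendsto_const, of _ 0 _ x] by simp
  qed simp
  hence "(\<lambda>i. real (base_digit a x i) / real a ^ Suc i) sums x"
    unfolding sums_def part .
  moreover have "base_digit a x i < a" for i
    using a by (simp add: base_digit_def)
  ultimately show ?thesis by (simp add: is_base_expansion_def)
qed

lemma is_base_expansion_iff_base_digit:
  assumes a: "a \<ge> 2" and x: "x \<in> {0..1}" "x \<notin> \<rat>"
  shows "is_base_expansion a x d \<longleftrightarrow> d = base_digit a x"
proof
  assume "d = base_digit a x"
  moreover have "x < 1" using x by (cases "x = 1") auto
  ultimately show "is_base_expansion a x d"
    using is_base_expansion_base_digit a x by simp
next
  assume "is_base_expansion a x d"
  hence d: "\<And>i. d i < a" and S: "(\<lambda>i. real (d i) / real a ^ Suc i) sums x"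
    by (auto simp: is_base_expansion_def)
  define N where "N n = (\<Sum>i<n. d i * a ^ (n - Suc i))" for n
  have NS: "N (Suc n) = a * N n + d n" for n
  proof -
    have "(\<Sum>i<n. d i * a ^ (n - i)) = a * N n"
      unfolding N_def sum_distrib_left
    proof (rule sum.cong)
      fix i assume "i \<in> {..<n}"
      hence "n - i = Suc (n - Suc i)" by auto
      thus "d i * a ^ (n - i) = a * (d i * a ^ (n - Suc i))" by simp
    qed simp
    thus ?thesis by (simp add: N_def)
  qed
  have NP: "(\<Sum>i<n. real (d i) / real a ^ Suc i) = real (N n) / real a ^ n" for n
  proof (induction n)
    case (Suc n)
    then show ?case using a by (simp add: NS field_simps)
  qed (simp add: N_def)
  have fl: "\<lfloor>real a ^ n * x\<rfloor> = int (N n)" for n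
  proof -
    have T: "(\<lambda>i. real (d (i + n)) / real a ^ Suc (i + n)) sums (x - real (N n) / real a ^ n)"
      using sums_split_initial_segment[OF S, of n] unfolding NP .
    have lo: "0 \<le> x - real (N n) / real a ^ n"
      by (rule sums_le[OF _ sums_zero T]) simp
    have "(\<lambda>i. (1 / real a) ^ i) sums (1 / (1 - 1 / real a))"
      using a by (intro geometric_sums) simp
    hence "(\<lambda>i. (real a - 1) / real a ^ Suc n * (1 / real a) ^ i) sums
            ((real a - 1) / real a ^ Suc n * (1 / (1 - 1 / real a)))"
      by (rule sums_mult)
    moreover have "(real a - 1) / real a ^ Suc n * (1 / (1 - 1 / real a)) = 1 / real a ^ n"
    proof -
      have "1 - 1 / real a = (real a - 1) / real a" using a by (simp add: field_simps)
      thus ?thesis using a by simp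
    qed
    moreover have "(real a - 1) / real a ^ Suc n * (1 / real a) ^ i = (real a - 1) / real a ^ Suc (i + n)" for i
      by (simp add: power_add power_one_over field_simps)
    ultimately have G: "(\<lambda>i. (real a - 1) / real a ^ Suc (i + n)) sums (1 / real a ^ n)"
      by simp
    have hi: "x - real (N n) / real a ^ n \<le> 1 / real a ^ n"
    proof (rule sums_le[OF _ T G])
      fix i show "real (d (i + n)) / real a ^ Suc (i + n) \<le> (real a - 1) / real a ^ Suc (i + n)"
        using d[of "i + n"] a by (intro divide_right_mono) auto
    qed
    have ne: "real a ^ n * x \<noteq> real (N n) + 1"
    proof
      assume "real a ^ n * x = real (N n) + 1"
      hence "x = (real (N n) + 1) / real a ^ n" using a by (simp add: field_simps)
      also have "\<dots> \<in> \<rat>" by simp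
      finally show False using x by simp
    qed
    have "x \<le> (real (N n) + 1) / real a ^ n"
      using hi by (simp add: add_divide_distrib)
    hence "real (N n) \<le> real a ^ n * x" "real a ^ n * x \<le> real (N n) + 1"
      using lo a by (auto simp: field_simps)
    thus ?thesis using ne by (intro floor_unique) auto
  qed
  show "d = base_digit a x"
  proof
    fix i
    show "d i = base_digit a x i"
      unfolding base_digit_def fl nat_int NS using d[of i] by simp
  qed
qed

end

theory Submission
  imports Defs "HOL-Analysis.Kronecker_Approximation_Theorem"
begin

text \<open>
  The digit sequence is a characteristic Sturmian word, the limit of standard words built by
  \<open>(u, v) \<mapsto> (u ^ d v, u)\<close> with exponents \<open>d\<close> chosen one after the other. Since \<open>uv\<close> and \<open>vu\<close> agree
  up to their last two letters, the limit has at most \<open>n + 1\<close> factors of length \<open>n = |u| + |v| - 1\<close>,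
  and irrationality gives the reverse inequality for all lengths.

  The exponents provide richness in base \<open>b\<close>: a number whose expansion starts with \<open>u ^ d v u ^ d\<close> is
  \<open>r + A ^ (- d) (\<delta> + \<epsilon>)\<close>, where \<open>A = a ^ |u|\<close>, the rational \<open>r\<close> has expansion \<open>uuu\<dots>\<close>, \<open>\<delta> \<noteq> 0\<close> does not
  depend on \<open>d\<close>, and \<open>\<epsilon>\<close> tends to \<open>0\<close> as \<open>d\<close> grows. Along an arithmetic progression of exponents \<open>k\<close> the
  fractional part of \<open>b ^ k r\<close> is constant, while by Kronecker's theorem \<open>b ^ k / A ^ d\<close> comes arbitrarily
  close to any given positive number. So some \<open>d\<close> and \<open>k\<close> bring the fractional part of \<open>b ^ k x\<close> into any
  given interval. There are countably many pairs of a base and a \<open>b\<close>-adic interval; each is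
  dealt with at one stage.
\<close>

section \<open>Powers of multiplicatively independent integers\<close>

lemma mult_independent_power:
  assumes "mult_independent a b" "m > 0" "n > 0"
  shows "mult_independent (a ^ m) (b ^ n)"
  using assms by (simp add: mult_independent_def flip: power_mult)

text \<open>Consecutive integers are coprime, and so are their powers. This gives one independent
  base that is always at hand, for stages without a target and for the irrationality of x.\<close>

lemma mult_independent_Suc:
  assumes "a \<ge> 2"
  shows "mult_independent a (Suc a)"
proof -
  have "coprime (a ^ m) (Suc a ^ n)" for m n
    by simp
  moreover have "a ^ m > 1" if "m > 0" for m
    using assms that by (intro one_less_power) auto
  ultimately show ?thesis
    unfolding mult_independent_def by (metis coprime_self less_irrefl nat_dvd_1_iff_1)
qed

lemma log_not_rational:
  assumes "a \<ge> 2" "b \<ge> 2" and ind: "mult_independent a b"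
  shows "log (real a) (real b) \<notin> \<rat>"
proof
  assume "log (real a) (real b) \<in> \<rat>"
  moreover have "log (real a) (real b) > 0"
    using assms by simp
  ultimately obtain m n :: nat where n: "n \<noteq> 0" and mn: "log (real a) (real b) = real m / real n"
    using Rats_abs_nat_div_natE by (metis abs_of_pos)
  with \<open>log (real a) (real b) > 0\<close> have "m > 0"
    by (cases m) auto
  have "real b ^ n = real a powr (log (real a) (real b) * real n)"
    using assms by (simp add: powr_powr[symmetric] powr_realpow)
  also have "\<dots> = real a ^ m"
    using mn n assms by (simp add: powr_realpow)
  finally have "a ^ m = b ^ n"
    by (metis of_nat_eq_iff of_nat_power)
  thus False
    using ind n \<open>m > 0\<close> by (simp add: mult_independent_def)
qed

text \<open>The quotient is a to the power j \<open>\<theta>\<close> - d with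
  \<open>\<theta>\<close> irrational. Kronecker's theorem brings this exponent close to
  \<open>\<alpha>\<close>, and continuity does the rest.\<close>

lemma power_quotients_dense:
  fixes \<rho> \<eta> :: real
  assumes ab: "a \<ge> 2" "b \<ge> 2" "mult_independent a b" and "\<rho> > 0" "\<eta> > 0"
  shows "\<exists>j d. d \<ge> D \<and> \<bar>real b ^ j / real a ^ d - \<rho>\<bar> < \<eta>"
proof -
  define \<theta> where "\<theta> = log (real a) (real b)"
  define \<alpha> where "\<alpha> = log (real a) \<rho>"
  have \<theta>: "\<theta> > 0" "\<theta> \<notin> \<rat>"
    using ab log_not_rational by (auto simp: \<theta>_def)
  have "isCont (\<lambda>y. real a powr y) \<alpha>"
    using ab by (intro continuous_intros) auto
  then obtain \<epsilon> where \<epsilon>: "\<epsilon> > 0"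
    and close: "\<And>y. \<bar>y - \<alpha>\<bar> < \<epsilon> \<Longrightarrow> \<bar>real a powr y - real a powr \<alpha>\<bar> < \<eta>"
    using \<open>\<eta> > 0\<close> unfolding continuous_at_real_range by (metis real_norm_def)
  have \<rho>: "real a powr \<alpha> = \<rho>"
    using ab \<open>\<rho> > 0\<close> by (simp add: \<alpha>_def)
  \<comment> \<open>Kronecker's theorem only gives \<open>k > 0\<close>. Shifting the multiplier by
    \<open>J\<close> forces \<open>h\<close>, the future \<open>d\<close>, above
    \<open>D\<close>.\<close>
  obtain J :: nat where J: "real J * \<theta> > \<alpha> + 1 + real D"
    using \<theta> reals_Archimedean3 by blast
  have "min \<epsilon> 1 > 0"
    using \<epsilon> by simp
  then obtain h k where "k > 0" and hk: "\<bar>of_int k * \<theta> - of_int h - (\<alpha> - real J * \<theta>)\<bar> < min \<epsilon> 1"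
    using sequence_of_fractional_parts_is_dense[OF \<theta>(2)] by metis
  define j where "j = nat k + J"
  have j: "real j * \<theta> = of_int k * \<theta> + real J * \<theta>"
    using \<open>k > 0\<close> by (simp add: j_def algebra_simps)
  have "of_int k * \<theta> > 0"
    using \<theta> \<open>k > 0\<close> by simp
  hence "of_int h > real D"
    using hk J by linarith
  then obtain d where d: "h = int d" "d \<ge> D"
    by (metis less_imp_le of_int_less_iff of_int_of_nat_eq of_nat_0_le_iff of_nat_less_iff
        order_trans zero_le_imp_eq_int)
  have "real b ^ j / real a ^ d = real a powr (real j * \<theta> - real d)"
  proof -
    have "real a powr (real j * \<theta>) = (real a powr \<theta>) powr real j"
      by (simp add: powr_powr mult.commute)
    thus ?thesis
      using ab by (simp add: powr_diff powr_realpow \<theta>_def)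
  qed
  moreover have "\<bar>real j * \<theta> - real d - \<alpha>\<bar> < \<epsilon>"
    using hk j d by (simp add: abs_less_iff)
  ultimately have "\<bar>real b ^ j / real a ^ d - \<rho>\<bar> < \<eta>"
    using close \<rho> by simp
  thus ?thesis
    using d by blast
qed

text \<open>Pigeonhole on residues modulo the denominator gives one return after p steps.
  Multiplying that integral difference by powers of b keeps it integral, so the return
  repeats.\<close>

lemma rational_orbit_periodic:
  fixes r :: real and b :: nat
  assumes "r \<in> \<rat>"
  obtains k p where "p > 0" "\<And>j. real b ^ (k + j * p) * r - real b ^ k * r \<in> \<int>"
proof -
  obtain m n :: int where n: "n > 0" and r: "r = of_int m / of_int n"
    using assms by (elim Rats_cases')
  have "\<not> inj (\<lambda>k. (int b ^ k * m) mod n)"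
  proof
    assume "inj (\<lambda>k. (int b ^ k * m) mod n)"
    moreover have "range (\<lambda>k. (int b ^ k * m) mod n) \<subseteq> {0..<n}"
      using n by auto
    ultimately have "finite (UNIV :: nat set)"
      using finite_subset finite_atLeastLessThan_int finite_imageD by metis
    thus False by simp
  qed
  then obtain k l where kl: "k < l" "(int b ^ l * m) mod n = (int b ^ k * m) mod n"
    unfolding inj_def by (metis linorder_neqE_nat)
  define p where "p = l - k"
  have p: "p > 0" "l = k + p"
    using kl by (auto simp: p_def)
  have step: "real b ^ (k + p) * r - real b ^ k * r \<in> \<int>"
  proof -
    obtain c where "int b ^ (k + p) * m - int b ^ k * m = n * c"
      using kl p by (metis dvdE mod_eq_dvd_iff)
    hence "real_of_int (int b ^ (k + p) * m - int b ^ k * m) = of_int (n * c)"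
      by (rule arg_cong)
    hence "real b ^ (k + p) * r - real b ^ k * r = of_int c"
      using n by (simp add: r field_simps)
    thus ?thesis by simp
  qed
  have "real b ^ (k + j * p) * r - real b ^ k * r \<in> \<int>" for j
  proof (induction j)
    case (Suc j)
    have "real b ^ (k + Suc j * p) * r - real b ^ k * r
        = real b ^ (j * p) * (real b ^ (k + p) * r - real b ^ k * r)
          + (real b ^ (k + j * p) * r - real b ^ k * r)"
      by (simp add: algebra_simps power_add)
    also have "\<dots> \<in> \<int>"
      using Suc step by (intro Ints_add Ints_mult Ints_power) auto
    finally show ?case .
  qed simp
  with p that show thesis by blast
qed

section \<open>Values of digit words\<close>

primrec word_value :: "nat \<Rightarrow> nat list \<Rightarrow> real" where
  "word_value a [] = 0"
| "word_value a (d # w) = (real d + word_value a w) / real a"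

text \<open>The value of the purely periodic expansion \<open>0.www\<dots>\<close>.\<close>
definition periodic_value :: "nat \<Rightarrow> nat list \<Rightarrow> real" where
  "periodic_value a w = word_value a w / (1 - 1 / real a ^ length w)"

definition word_power :: "nat list \<Rightarrow> nat \<Rightarrow> nat list" where
  "word_power w d = concat (replicate d w)"

lemma word_power_0 [simp]: "word_power w 0 = []"
  and word_power_Suc [simp]: "word_power w (Suc d) = w @ word_power w d"
  by (simp_all add: word_power_def)

lemma length_word_power [simp]: "length (word_power w d) = d * length w"
  by (induction d) simp_all

lemma word_value_append:
  "word_value a (u @ v) = word_value a u + word_value a v / real a ^ length u"
  by (induction u) (simp_all add: add_divide_distrib)

lemma word_value_rational: "word_value a w \<in> \<rat>"
  by (induction w) auto

lemma periodic_value_rational: "periodic_value a w \<in> \<rat>"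
  unfolding periodic_value_def by (intro Rats_divide Rats_diff word_value_rational) auto

text \<open>The periodic value is the only fixed point of prepending \<open>w\<close>; comparisons
  of periodic values are made through this form.\<close>

lemma periodic_value_iff:
  assumes "a \<ge> 2" "w \<noteq> []"
  shows "periodic_value a w = r \<longleftrightarrow> word_value a w + r / real a ^ length w = r"
proof -
  have "real a ^ length w > 1"
    using assms by (intro one_less_power) auto
  thus ?thesis
    unfolding periodic_value_def by (auto simp: field_simps)
qed

text \<open>Prepending \<open>u\<close> is injective and fixes r, so \<open>u @ v\<close> fixes r
  exactly when \<open>v\<close> does. This keeps \<open>\<delta>\<close> nonzero along the
  construction of standard pairs.\<close>

lemma periodic_value_append_eq:
  assumes "a \<ge> 2" "u \<noteq> []" "v \<noteq> []"
  shows "periodic_value a (u @ v) = periodic_value a u \<longleftrightarrow> periodic_value a v = periodic_value a u"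
proof -
  define r where "r = periodic_value a u"
  have u: "word_value a u + r / real a ^ length u = r"
    using assms r_def periodic_value_iff by blast
  have "periodic_value a (u @ v) = r \<longleftrightarrow>
      word_value a u + (word_value a v + r / real a ^ length v) / real a ^ length u = r"
    using assms by (subst periodic_value_iff)
      (auto simp: word_value_append add_divide_distrib power_add add.assoc mult.commute)
  also have "\<dots> \<longleftrightarrow> (word_value a v + r / real a ^ length v) / real a ^ length u = r / real a ^ length u"
    using u by linarith
  also have "\<dots> \<longleftrightarrow> word_value a v + r / real a ^ length v = r"
    using assms by simp
  also have "\<dots> \<longleftrightarrow> periodic_value a v = r"
    using assms by (subst periodic_value_iff) auto
  finally show ?thesis
    by (simp add: r_def)
qed

lemma periodic_value_power_append_eq:
  assumes "a \<ge> 2" "u \<noteq> []" "v \<noteq> []"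
  shows "periodic_value a (word_power u d @ v) = periodic_value a u \<longleftrightarrow> periodic_value a v = periodic_value a u"
proof (induction d)
  case (Suc d)
  thus ?case
    using periodic_value_append_eq[of a u "word_power u d @ v"] assms by simp
qed simp

lemma word_value_power:
  assumes "a \<ge> 2" "u \<noteq> []"
  shows "word_value a (word_power u d) = periodic_value a u * (1 - 1 / (real a ^ length u) ^ d)"
proof (induction d)
  case (Suc d)
  have "word_value a u = periodic_value a u * (1 - 1 / real a ^ length u)"
    using assms periodic_value_iff[of a u "periodic_value a u"] by (simp add: algebra_simps)
  hence "word_value a (word_power u (Suc d)) = periodic_value a u * (1 - 1 / real a ^ length u)
      + periodic_value a u * (1 - 1 / (real a ^ length u) ^ d) / real a ^ length u"
    using Suc by (simp add: word_value_append)
  also have "\<dots> = periodic_value a u * (1 - 1 / (real a ^ length u) ^ Suc d)"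
    using assms by (simp add: field_simps)
  finally show ?case .
qed simp

section \<open>Hitting an interval by an orbit\<close>

text \<open>A symmetric closed interval, twice as long as the set of numbers with an expansion
  starting with \<open>w\<close>: the estimates need only the distance, and closedness survives
  limits.\<close>

definition in_cylinder :: "nat \<Rightarrow> nat list \<Rightarrow> real \<Rightarrow> bool" where
  "in_cylinder a w x \<longleftrightarrow> \<bar>x - word_value a w\<bar> \<le> 1 / real a ^ length w"

text \<open>Geometric sums give the value y of the word exactly: (y - r) A^d misses the constant by
  r / (B A^d) only, since the second power of \<open>u\<close> imitates the tail uuu... of r. The
  digits after it cost at most another 1 / (B A^d).\<close>

lemma power_append_power_cylinder:
  assumes "a \<ge> 2" "u \<noteq> []" and x: "in_cylinder a (word_power u d @ v @ word_power u d) x"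
  defines "A \<equiv> real a ^ length u" and "r \<equiv> periodic_value a u"
  shows "\<bar>(x - r) * A ^ d - (word_value a v + r / real a ^ length v - r)\<bar> \<le> (\<bar>r\<bar> + 1) / A ^ d"
proof -
  define B where "B = real a ^ length v"
  have A: "A > 0" and B: "B \<ge> 1"
    using assms by (auto simp: A_def B_def)
  have Ad: "A ^ d > 0" using A by simp
  define y where "y = word_value a (word_power u d @ v @ word_power u d)"
  have len: "real a ^ length (word_power u d @ v @ word_power u d) = A ^ d * B * A ^ d"
    by (simp add: A_def B_def power_add power_mult[symmetric] mult_ac)
  have y: "y = r * (1 - 1 / A ^ d) + (word_value a v + r * (1 - 1 / A ^ d) / B) / A ^ d"
    using assms by (simp add: y_def word_value_append word_value_power A_def B_def r_def
        power_mult[symmetric] mult.commute[of _ "length u"])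
  have "(y - r) * A ^ d = word_value a v + r * (1 - 1 / A ^ d) / B - r"
  proof -
    have "(r * (1 - 1 / P) + z / P - r) * P = z - r" if "P > 0" for z P :: real
      using that by (simp add: field_simps)
    from this[OF Ad] show ?thesis
      unfolding y .
  qed
  hence "(y - r) * A ^ d - (word_value a v + r / B - r) = - r / (B * A ^ d)"
    by (simp add: diff_divide_distrib right_diff_distrib mult.commute)
  moreover have "\<bar>(x - y) * A ^ d\<bar> \<le> 1 / (B * A ^ d)"
  proof -
    have "\<bar>x - y\<bar> * A ^ d \<le> 1 / (A ^ d * B * A ^ d) * A ^ d"
      using x Ad unfolding in_cylinder_def len y_def by (intro mult_right_mono) auto
    also have "\<dots> = 1 / (B * A ^ d)"
      using A by simp
    finally show ?thesis
      using Ad by (simp add: abs_mult)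
  qed
  moreover have split: "(x - r) * A ^ d - (word_value a v + r / B - r)
      = (x - y) * A ^ d + ((y - r) * A ^ d - (word_value a v + r / B - r))"
    by (simp add: algebra_simps)
  ultimately have "\<bar>(x - r) * A ^ d - (word_value a v + r / B - r)\<bar> \<le> 1 / (B * A ^ d) + \<bar>- r / (B * A ^ d)\<bar>"
    by (metis split abs_triangle_ineq add_right_mono order_trans)
  also have "\<dots> = (\<bar>r\<bar> + 1) / A ^ d / B"
    using B Ad by (simp add: abs_mult add_divide_distrib mult.commute)
  also have "\<dots> \<le> (\<bar>r\<bar> + 1) / A ^ d"
    using divide_left_mono[of 1 B "(\<bar>r\<bar> + 1) / A ^ d"] B Ad by simp
  finally show ?thesis
    by (simp add: B_def)
qed

text \<open>For k = k0 + j p, b^k x equals c + b0 \<open>\<beta>\<close> (\<open>\<delta>\<close> +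
  \<open>\<epsilon>\<close>) modulo 1, where \<open>\<beta>\<close> = B^j / A^d. With
  \<open>\<beta>\<close> close to \<open>\<rho>\<close> this is close to the midpoint of the
  interval.\<close>

lemma orbit_hits_interval:
  assumes ab: "a \<ge> 2" "b \<ge> 2" "mult_independent a b"
    and uv: "u \<noteq> []" "v \<noteq> []" "periodic_value a v \<noteq> periodic_value a u"
    and st: "0 \<le> s" "s < t" "t \<le> 1"
  obtains d k where "d \<ge> 1"
    "\<And>x. in_cylinder a (word_power u d @ v @ word_power u d) x \<Longrightarrow> frac (real b ^ k * x) \<in> {s<..<t}"
proof -
  define r where "r = periodic_value a u"
  define \<delta> where "\<delta> = word_value a v + r / real a ^ length v - r"
  define A where "A = a ^ length u"
  define C where "C = \<bar>r\<bar> + 1"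
  have \<delta>: "\<delta> \<noteq> 0"
    using uv ab periodic_value_iff[of a v r] by (simp add: \<delta>_def r_def)
  have "1 < a ^ length u"
    using ab uv by (intro one_less_power) auto
  hence A: "A \<ge> 2"
    by (simp add: A_def)
  obtain k0 p where p: "p > 0" and per: "\<And>j. real b ^ (k0 + j * p) * r - real b ^ k0 * r \<in> \<int>"
    using rational_orbit_periodic[of r b] periodic_value_rational by (metis r_def)
  define B where "B = b ^ p"
  have "1 < b ^ p"
    using ab p by (intro one_less_power) auto
  hence B: "B \<ge> 2"
    by (simp add: B_def)
  have indAB: "mult_independent A B"
    unfolding A_def B_def using ab uv p by (intro mult_independent_power) auto
  define c where "c = real b ^ k0 * r"
  define b0 where "b0 = real b ^ k0"
  have b0: "b0 > 0"
    using ab by (simp add: b0_def)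
  \<comment> \<open>Quotients of powers are positive, so \<open>\<tau>\<close> must have the sign of
    \<open>\<delta>\<close>; an integer shift achieves this and changes nothing modulo 1.\<close>
  obtain M :: int where M: "((s + t) / 2 - c + of_int M) / \<delta> > 0"
  proof -
    define q where "q = (s + t) / 2 - c"
    show thesis
    proof (cases "\<delta> > 0")
      case True
      have "(q + of_int (\<lceil>- q\<rceil> + 1)) / \<delta> > 0"
        using True by (intro divide_pos_pos) linarith+
      with that show thesis unfolding q_def by blast
    next
      case False
      have "(q + of_int (\<lfloor>- q\<rfloor> - 1)) / \<delta> > 0"
        using False \<delta> by (intro divide_neg_neg) linarith+
      with that show thesis unfolding q_def by blast
    qed
  qed
  define \<tau> where "\<tau> = (s + t) / 2 - c + of_int M"
  define \<rho> where "\<rho> = \<tau> / \<delta> / b0"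
  have \<rho>: "\<rho> > 0"
    unfolding \<rho>_def \<tau>_def using M b0 by (rule divide_pos_pos)
  \<comment> \<open>Two errors below \<open>w\<close>, one from \<open>\<epsilon>\<close> and one
    from \<open>\<beta> - \<rho>\<close>, together stay below half the length of the
    interval.\<close>
  define w where "w = (t - s) / 4"
  have w: "w > 0"
    using st by (simp add: w_def)
  \<comment> \<open>The bound 1 keeps \<open>\<beta>\<close> below \<open>\<rho> + 1\<close>, so
    \<open>D\<close> can be fixed before \<open>\<beta>\<close> is known and still force the
    contribution of \<open>\<epsilon>\<close> below \<open>w\<close>.\<close>
  define \<eta> where "\<eta> = min 1 (w / (b0 * \<bar>\<delta>\<bar>))"
  have \<eta>: "\<eta> > 0"
    using w b0 \<delta> by (simp add: \<eta>_def)
  obtain D :: nat where D: "real A ^ D > b0 * (\<rho> + 1) * C / w"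
    using real_arch_pow[of "real A"] A by (metis numeral_le_real_of_nat_iff less_le_trans one_less_numeral_iff semiring_norm(76))
  obtain j d where d: "d \<ge> Suc D" and jd: "\<bar>real B ^ j / real A ^ d - \<rho>\<bar> < \<eta>"
    using power_quotients_dense[OF A B indAB \<rho> \<eta>] by blast
  define k where "k = k0 + j * p"
  define \<beta> where "\<beta> = real B ^ j / real A ^ d"
  have \<beta>: "0 < \<beta>" "\<beta> < \<rho> + 1" "\<bar>\<beta> - \<rho>\<bar> < w / (b0 * \<bar>\<delta>\<bar>)"
    using jd A B unfolding \<beta>_def \<eta>_def by (auto simp: abs_less_iff)
  have bk: "real b ^ k = b0 * \<beta> * real A ^ d"
    using A by (simp add: k_def b0_def \<beta>_def B_def power_add power_mult mult.commute[of j])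
  show thesis
  proof
    show "d \<ge> 1"
      using d by simp
    fix x
    assume x: "in_cylinder a (word_power u d @ v @ word_power u d) x"
    define \<epsilon> where "\<epsilon> = (x - r) * real A ^ d - \<delta>"
    have Ad: "real A ^ d > 0"
      using A by simp
    have "\<bar>\<epsilon>\<bar> \<le> C / real A ^ d"
      using power_append_power_cylinder[OF ab(1) uv(1) x]
      by (simp add: \<epsilon>_def \<delta>_def r_def A_def C_def)
    also have "\<dots> \<le> C / real A ^ D"
      using A d by (intro divide_left_mono power_increasing) (auto simp: C_def)
    finally have "b0 * \<beta> * \<bar>\<epsilon>\<bar> \<le> b0 * (\<rho> + 1) * (C / real A ^ D)"
      using b0 \<beta> by (intro mult_mono) auto
    also have "\<dots> < w"
      using D w A by (simp add: field_simps)
    finally have e1: "\<bar>b0 * \<beta> * \<epsilon>\<bar> < w"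
      using b0 \<beta> by (simp add: abs_mult)
    have "\<bar>\<beta> - \<rho>\<bar> * (b0 * \<bar>\<delta>\<bar>) < w"
      using \<beta>(3) b0 \<delta> by (simp add: less_divide_eq)
    hence "\<bar>(\<beta> - \<rho>) * (b0 * \<delta>)\<bar> < w"
      using b0 by (simp add: abs_mult)
    moreover have "(\<beta> - \<rho>) * (b0 * \<delta>) = b0 * \<beta> * \<delta> - \<tau>"
      using b0 \<delta> by (simp add: \<rho>_def left_diff_distrib)
    ultimately have e2: "\<bar>b0 * \<beta> * \<delta> - \<tau>\<bar> < w"
      by simp
    have "real b ^ k * (x - r) = b0 * \<beta> * (\<delta> + \<epsilon>)"
      by (simp add: bk \<epsilon>_def)
    hence e3: "real b ^ k * x = real b ^ k * r + b0 * \<beta> * \<delta> + b0 * \<beta> * \<epsilon>"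
      by (simp add: algebra_simps)
    obtain z where z: "real b ^ k * r - c = of_int z"
      using per[of j] unfolding k_def c_def by (elim Ints_cases)
    define f where "f = real b ^ k * x - of_int (z + M)"
    have "\<bar>f - (s + t) / 2\<bar> < 2 * w"
      using e1 e2 e3 z unfolding f_def \<tau>_def by (simp add: abs_less_iff)
    hence "\<bar>f - (s + t) / 2\<bar> < (t - s) / 2"
      by (simp add: w_def)
    hence "s < f" and "f < t"
      unfolding abs_less_iff by argo+
    note f = this
    have "frac (real b ^ k * x) = f"
      unfolding frac_unique_iff using f st by (auto simp: f_def)
    thus "frac (real b ^ k * x) \<in> {s<..<t}"
      using f by simp
  qed
qed

section \<open>Windows of an infinite word\<close>

definition windows :: "nat \<Rightarrow> (nat \<Rightarrow> nat) \<Rightarrow> nat list set" where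
  "windows n d = range (\<lambda>k. map d [k..<k + n])"

lemma finite_windows:
  assumes "finite (range d)"
  shows "finite (windows n d)"
proof (rule finite_subset)
  show "windows n d \<subseteq> {w. set w \<subseteq> range d \<and> length w = n}"
    by (auto simp: windows_def)
  show "finite {w. set w \<subseteq> range d \<and> length w = n}"
    using assms by (rule finite_lists_length_eq)
qed

lemma map_upt_eq_iff:
  "map d [i..<i + n] = map d [j..<j + n] \<longleftrightarrow> (\<forall>t<n. d (i + t) = d (j + t))"
  by (simp add: list_eq_iff_nth_eq)

text \<open>
  If there are no more windows of length \<open>n + 1\<close> than of length \<open>n\<close>, every window determines the
  letter following it, so two equal windows at different positions have equal continuations.
\<close>
lemma card_windows_less:
  assumes fin: "finite (range d)" and aper: "\<And>i j. i < j \<Longrightarrow> \<exists>t. d (i + t) \<noteq> d (j + t)"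
  shows "card (windows n d) < card (windows (Suc n) d)"
proof (rule ccontr)
  assume "\<not> card (windows n d) < card (windows (Suc n) d)"
  hence le: "card (windows (Suc n) d) \<le> card (windows n d)" by simp
  have "take n (map d [k..<k + Suc n]) = map d [k..<k + n]" for k
    by (simp add: take_map)
  hence im: "take n ` windows (Suc n) d = windows n d"
    unfolding windows_def image_image by simp
  have inj: "inj_on (take n) (windows (Suc n) d)"
  proof (rule eq_card_imp_inj_on)
    show "card (take n ` windows (Suc n) d) = card (windows (Suc n) d)"
      using le card_image_le[OF finite_windows[OF fin], of "take n" "Suc n"] by (simp add: im)
  qed (rule finite_windows[OF fin])
  have ext: "\<forall>t<Suc n. d (i + t) = d (j + t)" if "\<forall>t<n. d (i + t) = d (j + t)" for i j
  proof -
    have "map d [i..<i + Suc n] = map d [j..<j + Suc n]"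
    proof (rule inj_onD[OF inj])
      show "take n (map d [i..<i + Suc n]) = take n (map d [j..<j + Suc n])"
        using that map_upt_eq_iff[of d i n j] by (simp add: take_map)
    qed (auto simp: windows_def simp del: upt_Suc)
    thus ?thesis
      using map_upt_eq_iff by blast
  qed
  have "\<not> inj (\<lambda>k. map d [k..<k + n])"
    using finite_windows[OF fin, of n] finite_imageD infinite_UNIV_nat unfolding windows_def by blast
  then obtain i j where "i < j" and "\<forall>t<n. d (i + t) = d (j + t)"
    unfolding inj_def map_upt_eq_iff by (metis linorder_neqE_nat)
  hence run: "\<forall>t<n. d (i + m + t) = d (j + m + t)" for m
  proof (induction m)
    case (Suc m)
    show ?case
    proof (intro allI impI)
      fix t assume "t < n"
      hence "d (i + m + Suc t) = d (j + m + Suc t)"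
        using ext[OF Suc.IH[OF Suc.prems]] by blast
      thus "d (i + Suc m + t) = d (j + Suc m + t)"
        by simp
    qed
  qed simp
  have "d (i + m) = d (j + m)" for m
    using ext[OF run[of m]] by (metis add_0_right zero_less_Suc)
  with aper[OF \<open>i < j\<close>] show False by blast
qed

text \<open>Strict growth from 1 at length 0 gives at least n + 1, and any excess at length n would
  persist at all greater lengths. Hence an upper bound at arbitrarily large lengths
  suffices.\<close>

lemma card_windows_eq:
  assumes fin: "finite (range d)" and aper: "\<And>i j. i < j \<Longrightarrow> \<exists>t. d (i + t) \<noteq> d (j + t)"
    and upper: "\<And>n. \<exists>m\<ge>n. card (windows m d) \<le> Suc m"
  shows "card (windows n d) = Suc n"
proof -
  have grow: "card (windows n d) + k \<le> card (windows (n + k) d)" for n k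
  proof (induction k)
    case (Suc k)
    thus ?case
      using card_windows_less[OF fin aper, of "n + k"] by simp
  qed simp
  obtain m where "m \<ge> n" "card (windows m d) \<le> Suc m"
    using upper by blast
  moreover have "card (windows n d) + (m - n) \<le> card (windows m d)"
    using grow[of n "m - n"] \<open>m \<ge> n\<close> by simp
  moreover have "card (windows 0 d) = 1"
    by (simp add: windows_def)
  moreover have "card (windows 0 d) + n \<le> card (windows n d)"
    using grow[of 0 n] by simp
  ultimately show ?thesis by linarith
qed

section \<open>Concatenations of two almost commuting words\<close>

text \<open>The submonoid generated by \<open>u\<close> and \<open>v\<close>.\<close>

definition block_words :: "nat list \<Rightarrow> nat list \<Rightarrow> nat list set" where
  "block_words u v = concat ` lists {u, v}"

lemma block_words_Nil: "[] \<in> block_words u v"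
  unfolding block_words_def by (rule image_eqI[of _ _ "[]"]) auto

lemma block_words_left: "u \<in> block_words u v"
  unfolding block_words_def by (rule image_eqI[of _ _ "[u]"]) auto

lemma block_words_right: "v \<in> block_words u v"
  unfolding block_words_def by (rule image_eqI[of _ _ "[v]"]) auto

lemma block_words_append:
  assumes "x \<in> block_words u v" "y \<in> block_words u v"
  shows "x @ y \<in> block_words u v"
proof -
  obtain xs ys where "xs \<in> lists {u, v}" "x = concat xs" "ys \<in> lists {u, v}" "y = concat ys"
    using assms by (auto simp: block_words_def)
  hence "xs @ ys \<in> lists {u, v}" "x @ y = concat (xs @ ys)"
    by auto
  thus ?thesis
    unfolding block_words_def by (rule rev_image_eqI)
qed

lemma block_words_power: "x \<in> block_words u v \<Longrightarrow> word_power x d \<in> block_words u v"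
  by (induction d) (auto intro: block_words_Nil block_words_append)

lemma block_words_induct [consumes 1, case_names Nil append]:
  assumes "w \<in> block_words u v" "P []"
    and "\<And>b w. b \<in> {u, v} \<Longrightarrow> w \<in> block_words u v \<Longrightarrow> P w \<Longrightarrow> P (b @ w)"
  shows "P w"
proof -
  obtain ws where "set ws \<subseteq> {u, v}" "w = concat ws"
    using assms(1) by (auto simp: block_words_def)
  thus ?thesis
  proof (induction ws arbitrary: w)
    case (Cons b ws)
    thus ?case
      using assms(3)[of b "concat ws"] by (auto simp: block_words_def lists_eq_set)
  qed (use assms(2) in simp)
qed

lemma block_words_trans:
  assumes "w \<in> block_words u' v'" "u' \<in> block_words u v" "v' \<in> block_words u v"
  shows "w \<in> block_words u v"
  using assms(1) by (induction rule: block_words_induct)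
    (use assms in \<open>auto intro: block_words_Nil block_words_append\<close>)

definition almost_commute :: "nat list \<Rightarrow> nat list \<Rightarrow> bool" where
  "almost_commute u v \<longleftrightarrow>
     take (length u + length v - 2) (u @ v) = take (length u + length v - 2) (v @ u)"

text \<open>The two words to compare are u^d v u and u u^d v = u^d u v; after the common prefix u^d
  only vu and uv remain.\<close>

lemma almost_commute_step:
  assumes "almost_commute u v" "length u + length v \<ge> 2"
  shows "almost_commute (word_power u d @ v) u"
proof -
  have comm: "word_power u d @ u = u @ word_power u d"
    by (induction d) auto
  define l where "l = length u + length v - 2"
  have "length (word_power u d @ v) + length u - 2 = length (word_power u d) + l"
    using assms by (simp add: l_def)
  moreover have "take (length (word_power u d) + l) (word_power u d @ v @ u)
      = take (length (word_power u d) + l) (word_power u d @ u @ v)"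
    using assms by (simp add: almost_commute_def l_def)
  ultimately show ?thesis
    unfolding almost_commute_def using comm by (metis append.assoc)
qed

text \<open>After the first block the remaining word starts, by induction, like both uv and vu. The
  order that begins with the other block completes the first one to a prefix of uv or of vu.\<close>

lemma take_block_word:
  assumes uv: "almost_commute u v" "u \<noteq> []" "v \<noteq> []"
    and "w \<in> block_words u v" "l \<le> length u + length v - 2" "l \<le> length w"
  shows "take l w = take l (u @ v)"
  using assms(4-6)
proof (induction arbitrary: l rule: block_words_induct)
  case (append b w)
  have comm: "take l (u @ v) = take l (v @ u)"
    using uv(1) append.prems(1) unfolding almost_commute_def by (metis min.absorb1 take_take)
  show ?case
  proof (cases "l \<le> length b")
    case True
    thus ?thesis using append.hyps(1) comm by auto
  next
    case False
    define m where "m = l - length b"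
    have m: "m \<le> length u + length v - 2" "m \<le> length w"
      using append.prems False by (auto simp: m_def)
    have IH: "take m w = take m (u @ v)" "take m w = take m (v @ u)"
    proof -
      show 1: "take m w = take m (u @ v)"
        by (rule append.IH[OF m])
      show "take m w = take m (v @ u)"
        using uv(1) m(1) unfolding 1 almost_commute_def by (metis min.absorb1 take_take)
    qed
    have "take l (b @ w) = b @ take m w"
      using False by (simp add: m_def)
    also have "\<dots> = take l (u @ v)"
    proof (cases "b = u")
      case True
      have "m \<le> length v"
        using append.prems(1) False True by (auto simp: m_def)
      thus ?thesis
        using IH(2) False True by (simp add: m_def)
    next
      case bv: False
      hence "b = v" using append.hyps(1) by simp
      have "m \<le> length u"
        using append.prems(1) False \<open>b = v\<close> by (auto simp: m_def)
      thus ?thesis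
        using IH(1) False \<open>b = v\<close> comm by (simp add: m_def)
    qed
    finally show ?thesis .
  qed
qed simp

text \<open>A factor starts inside some block, and at most |u| + |v| - 2 of its letters lie beyond
  that block. There the following blocks may be replaced by uv, so only the block and the offset
  matter, which leaves |u| + |v| = n + 1 choices.\<close>

lemma factor_of_block_word:
  assumes uv: "almost_commute u v" "u \<noteq> []" "v \<noteq> []"
    and w: "w \<in> block_words u v" and n: "n = length u + length v - 1" and "k + n \<le> length w"
  shows "take n (drop k w) \<in> (\<lambda>j. take n (drop j (u @ u @ v))) ` {..<length u}
                          \<union> (\<lambda>j. take n (drop j (v @ u @ v))) ` {..<length v}"
  using w \<open>k + n \<le> length w\<close>
proof (induction arbitrary: k rule: block_words_induct)
  case Nil
  have "length u + length v - 1 > 0"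
    using uv by (cases u; cases v) auto
  with Nil n show ?case by simp
next
  case (append b w)
  show ?case
  proof (cases "k < length b")
    case True
    define l where "l = n - (length b - k)"
    have "take l w = take l (u @ v)"
    proof (rule take_block_word[OF uv append.hyps(2)])
      show "l \<le> length u + length v - 2" "l \<le> length w"
        using True append.prems n by (auto simp: l_def)
    qed
    hence "take n (drop k (b @ w)) = take n (drop k (b @ u @ v))"
      using True by (simp add: l_def)
    thus ?thesis
      using True append.hyps(1) by blast
  next
    case False
    thus ?thesis
      using append.IH[of "k - length b"] append.prems by simp
  qed
qed

lemma card_windows_le:
  assumes uv: "almost_commute u v" "u \<noteq> []" "v \<noteq> []"
    and cover: "\<And>i. \<exists>w\<in>block_words u v. length w \<ge> i \<and> map d [0..<length w] = w"
    and n: "n = length u + length v - 1"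
  shows "card (windows n d) \<le> Suc n"
proof -
  define F where "F = (\<lambda>j. take n (drop j (u @ u @ v))) ` {..<length u}
                    \<union> (\<lambda>j. take n (drop j (v @ u @ v))) ` {..<length v}"
  have "windows n d \<subseteq> F"
  proof
    fix z assume "z \<in> windows n d"
    then obtain k where k: "z = map d [k..<k + n]"
      by (auto simp: windows_def)
    obtain w where w: "w \<in> block_words u v" "length w \<ge> k + n" "map d [0..<length w] = w"
      using cover by blast
    have "take n (drop k (map d [0..<length w])) = z"
      using w(2) by (simp add: k take_map drop_map)
    hence "z = take n (drop k w)"
      using w(3) by simp
    thus "z \<in> F"
      unfolding F_def using factor_of_block_word[OF uv w(1) n w(2)] by simp
  qed
  moreover have "card F \<le> length u + length v"
  proof -
    have "card F \<le> card {..<length u} + card {..<length v}"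
      unfolding F_def by (intro order_trans[OF card_Un_le] add_mono card_image_le) auto
    thus ?thesis by simp
  qed
  moreover have "finite F"
    by (simp add: F_def)
  moreover have "length u > 0"
    using uv by simp
  ultimately show ?thesis
    using card_mono[of F "windows n d"] n by linarith
qed

section \<open>Digits and complexity\<close>

lemma base_words_eq_windows:
  assumes "a \<ge> 2"
  shows "base_words a n x = windows n (base_digit a x)"
proof -
  have dig: "base_digit a x i < a" for i
    using assms by (simp add: base_digit_def)
  have "length w = n \<and> (\<forall>i<n. w ! i = base_digit a x (k + i)) \<longleftrightarrow> w = map (base_digit a x) [k..<k + n]" for w k
    unfolding list_eq_iff_nth_eq by (simp cong: conj_cong)
  hence "base_words a n x = {w. set w \<subseteq> {..<a} \<and> (\<exists>k. w = map (base_digit a x) [k..<k + n])}"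
    unfolding base_words_def by blast
  also have "\<dots> = windows n (base_digit a x)"
    using dig by (auto simp: windows_def)
  finally show ?thesis .
qed

text \<open>The integer part of b^k x, multiplied by b^(i + 1), vanishes modulo b, so the digit is
  read off the fractional part, whose first n digits are those of m, leading digit first.\<close>

lemma base_digit_in_interval:
  assumes b: "b \<ge> 2" and "x \<ge> 0" "i < n"
    and f: "frac (real b ^ k * x) \<in> {real m / real b ^ n<..<(real m + 1) / real b ^ n}"
  shows "base_digit b x (k + i) = m div b ^ (n - Suc i) mod b"
proof -
  define f where "f = frac (real b ^ k * x)"
  define I where "I = nat \<lfloor>real b ^ k * x\<rfloor>"
  have I: "real b ^ k * x = real I + f"
    using assms by (simp add: I_def f_def frac_def)
  have nat_floor: "nat \<lfloor>real b ^ Suc i * f\<rfloor> = m div b ^ (n - Suc i)"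
  proof -
    define e where "e = n - Suc i"
    have n: "n = e + Suc i"
      using assms by (simp add: e_def)
    have fm: "real m < f * real b ^ n" "f * real b ^ n < real m + 1"
      using f b by (auto simp: f_def field_simps)
    have fe: "f * real b ^ n = real b ^ Suc i * f * real b ^ e"
      by (simp add: n power_add)
    define q where "q = m div b ^ e"
    have "q * b ^ e \<le> m"
      by (simp add: q_def)
    moreover have "m < Suc q * b ^ e"
      using b by (simp add: q_def dividend_less_div_times)
    \<comment> \<open>Integrality turns the strict bound on \<open>m\<close> into one on
      \<open>m + 1\<close>, the upper end of the interval.\<close>
    ultimately have "real (q * b ^ e) \<le> real m" "real m + 1 \<le> real (Suc q * b ^ e)"
      by linarith+
    hence "real q * real b ^ e < real b ^ Suc i * f * real b ^ e"
          "real b ^ Suc i * f * real b ^ e < (real q + 1) * real b ^ e"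
      using fm unfolding fe by (simp_all add: ring_distribs)
    hence "real q < real b ^ Suc i * f" "real b ^ Suc i * f < real q + 1"
      using b by simp_all
    hence "\<lfloor>real b ^ Suc i * f\<rfloor> = int q"
      by (intro floor_unique) auto
    thus ?thesis
      by (simp add: q_def e_def)
  qed
  have "real b ^ Suc (k + i) * x = real b ^ Suc i * (real b ^ k * x)"
    by (simp add: power_add)
  also have "\<dots> = real (b ^ Suc i * I) + real b ^ Suc i * f"
    unfolding I by (simp add: distrib_left)
  finally have split: "real b ^ Suc (k + i) * x = real (b ^ Suc i * I) + real b ^ Suc i * f" .
  have "nat \<lfloor>real N + y\<rfloor> = N + nat \<lfloor>y\<rfloor>" if "y \<ge> 0" for N y
    using that by (simp add: nat_add_distrib)
  moreover have "real b ^ Suc i * f \<ge> 0"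
    by (simp add: f_def)
  ultimately have "nat \<lfloor>real b ^ Suc (k + i) * x\<rfloor> = b ^ Suc i * I + m div b ^ (n - Suc i)"
    unfolding split nat_floor[symmetric] by blast
  thus ?thesis
    by (simp add: base_digit_def mult.assoc)
qed

lemma eq_if_digits_eq:
  fixes b :: nat
  assumes "m < b ^ n" "m' < b ^ n" "\<And>i. i < n \<Longrightarrow> m div b ^ i mod b = m' div b ^ i mod b"
  shows "m = m'"
  using assms
proof (induction n arbitrary: m m')
  case (Suc n)
  have "m div b = m' div b"
  proof (rule Suc.IH)
    fix i assume "i < n"
    thus "m div b div b ^ i mod b = m' div b div b ^ i mod b"
      using Suc.prems(3)[of "Suc i"] by (simp add: div_mult2_eq)
  qed (use Suc.prems in \<open>auto simp: less_mult_imp_div_less mult.commute\<close>)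
  moreover have "m mod b = m' mod b"
    using Suc.prems(3)[of 0] by simp
  ultimately show ?case
    by (metis div_mult_mod_eq)
qed simp

text \<open>The n-digit representations of the numbers m < b^n are distinct words, and each occurs
  where the orbit enters the interval of m.\<close>

lemma base_complexity_maximal:
  assumes b: "b \<ge> 2" and "x \<ge> 0"
    and hits: "\<And>m. m < b ^ n \<Longrightarrow> \<exists>k. frac (real b ^ k * x) \<in> {real m / real b ^ n<..<(real m + 1) / real b ^ n}"
  shows "base_complexity b n x = b ^ n"
proof -
  define dig where "dig m = map (\<lambda>i. m div b ^ (n - Suc i) mod b) [0..<n]" for m
  have inj: "inj_on dig {..<b ^ n}"
  proof (rule inj_onI)
    fix m m' assume m: "m \<in> {..<b ^ n}" "m' \<in> {..<b ^ n}" "dig m = dig m'"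
    show "m = m'"
    proof (rule eq_if_digits_eq)
      fix i assume "i < n"
      hence "n - Suc i < n" "n - Suc (n - Suc i) = i"
        by auto
      thus "m div b ^ i mod b = m' div b ^ i mod b"
        using arg_cong[OF m(3), of "\<lambda>w. w ! (n - Suc i)"] by (simp add: dig_def)
    qed (use m in auto)
  qed
  have words: "base_words b n x \<subseteq> {w. set w \<subseteq> {..<b} \<and> length w = n}"
    by (auto simp: base_words_def)
  have "dig ` {..<b ^ n} \<subseteq> base_words b n x"
  proof clarify
    fix m assume "m < b ^ n"
    then obtain k where "frac (real b ^ k * x) \<in> {real m / real b ^ n<..<(real m + 1) / real b ^ n}"
      using hits by blast
    hence "\<forall>i<n. dig m ! i = base_digit b x (k + i)"
      using base_digit_in_interval[OF b \<open>x \<ge> 0\<close>] by (simp add: dig_def)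
    moreover have "length (dig m) = n" "set (dig m) \<subseteq> {..<b}"
      using b by (auto simp: dig_def)
    ultimately show "dig m \<in> base_words b n x"
      unfolding base_words_def by blast
  qed
  hence "card (dig ` {..<b ^ n}) \<le> card (base_words b n x)"
    using words finite_subset finite_lists_length_eq[of "{..<b}" n] by (intro card_mono) auto
  hence "b ^ n \<le> card (base_words b n x)"
    using card_image[OF inj] by simp
  moreover have "card (base_words b n x) \<le> b ^ n"
    using card_mono[OF _ words] finite_lists_length_eq[of "{..<b}" n] card_lists_length_eq[of "{..<b}" n] by simp
  ultimately show ?thesis
    by (simp add: base_complexity_def)
qed

text \<open>For x = p / q every fractional part of b^k x is a multiple of 1 / q, hence zero or at
  least 1 / q.\<close>

lemma irrational_if_small_fracs:
  assumes b: "b \<ge> 2" and small: "\<And>n. \<exists>k. frac (real b ^ k * x) \<in> {0<..<1 / real b ^ n}"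
  shows "x \<notin> \<rat>"
proof
  assume "x \<in> \<rat>"
  then obtain p q :: int where q: "q > 0" and x: "x = of_int p / of_int q"
    by (elim Rats_cases')
  obtain n where n: "real_of_int q < real b ^ n"
    using real_arch_pow[of "real b" "real_of_int q"] b by auto
  obtain k where k: "0 < frac (real b ^ k * x)" "frac (real b ^ k * x) < 1 / real b ^ n"
    using small[of n] by auto
  define z where "z = int b ^ k * p - q * \<lfloor>real b ^ k * x\<rfloor>"
  have z: "of_int z = of_int q * frac (real b ^ k * x)"
    using q by (simp add: z_def x frac_def algebra_simps)
  have "real_of_int z > 0"
    unfolding z using q k by simp
  moreover have "real_of_int z < 1"
  proof -
    have "real_of_int z < of_int q * (1 / real b ^ n)"
      unfolding z using q k by (intro mult_strict_left_mono) auto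
    also have "\<dots> < 1"
      using n b by simp
    finally show ?thesis .
  qed
  ultimately show False
    by simp
qed

section \<open>Partial sums, cylinders and tails of expansions\<close>

lemma sum_eq_word_value:
  "(\<Sum>i<n. real (d i) / real a ^ Suc i) = word_value a (map d [0..<n])"
  by (induction n) (simp_all add: word_value_append)

lemma word_value_bounds:
  assumes "a \<ge> 1" "set w \<subseteq> {..<a}"
  shows "0 \<le> word_value a w" "word_value a w + 1 / real a ^ length w \<le> 1"
proof -
  show "0 \<le> word_value a w"
    by (induction w) auto
  show "word_value a w + 1 / real a ^ length w \<le> 1"
    using assms(2)
  proof (induction w)
    case (Cons d w)
    have "real d + 1 \<le> real a"
      using Cons.prems by auto
    moreover have "word_value a w + 1 / real a ^ length w \<le> 1"
      using Cons by simp
    ultimately have "(real d + (word_value a w + 1 / real a ^ length w)) / real a \<le> real a / real a"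
      by (intro divide_right_mono) auto
    thus ?case
      using assms(1) by (simp add: add_divide_distrib mult.commute)
  qed simp
qed

text \<open>The value of \<open>z\<close> and the radius belonging to \<open>z\<close> add up to at
  most 1, so the shift of the centre and the new radius together fit into the old radius.\<close>

lemma in_cylinder_prefix:
  assumes "a \<ge> 1" "set z \<subseteq> {..<a}" "in_cylinder a (w @ z) x"
  shows "in_cylinder a w x"
proof -
  have "0 \<le> word_value a z / real a ^ length w"
    using assms word_value_bounds(1)[of a z] by simp
  hence "\<bar>x - word_value a w\<bar> \<le> word_value a z / real a ^ length w + 1 / real a ^ length (w @ z)"
    using assms(3) unfolding in_cylinder_def word_value_append by linarith
  also have "\<dots> = (word_value a z + 1 / real a ^ length z) / real a ^ length w"
    by (simp add: power_add add_divide_distrib mult.commute)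
  also have "\<dots> \<le> 1 / real a ^ length w"
    using word_value_bounds(2)[OF assms(1,2)] by (intro divide_right_mono) auto
  finally show ?thesis
    by (simp add: in_cylinder_def)
qed

text \<open>All longer partial sums lie in the cylinder of the prefix, and the cylinder is
  closed.\<close>

lemma in_cylinder_expansion:
  assumes "a \<ge> 1" "is_base_expansion a x d"
  shows "in_cylinder a (map d [0..<n]) x"
proof -
  have "(\<lambda>N. word_value a (map d [0..<N])) \<longlonglongrightarrow> x"
    using assms(2) unfolding is_base_expansion_def sums_def sum_eq_word_value by blast
  hence "(\<lambda>N. \<bar>word_value a (map d [0..<N]) - word_value a (map d [0..<n])\<bar>)
      \<longlonglongrightarrow> \<bar>x - word_value a (map d [0..<n])\<bar>"
    by (intro tendsto_intros)
  moreover have "\<bar>word_value a (map d [0..<N]) - word_value a (map d [0..<n])\<bar> \<le> 1 / real a ^ n" if "N \<ge> n" for N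
  proof -
    have "[0..<N] = [0..<n] @ [n..<N]"
      using that upt_add_eq_append[of 0 n "N - n"] by simp
    hence "map d [0..<N] = map d [0..<n] @ map d [n..<N]"
      by simp
    moreover have "in_cylinder a (map d [0..<N]) (word_value a (map d [0..<N]))"
      by (simp add: in_cylinder_def)
    ultimately show ?thesis
      using in_cylinder_prefix[OF assms(1), of "map d [n..<N]" "map d [0..<n]"] assms(2)
      by (auto simp: in_cylinder_def is_base_expansion_def image_subset_iff)
  qed
  ultimately have "\<bar>x - word_value a (map d [0..<n])\<bar> \<le> 1 / real a ^ n"
    by (intro LIMSEQ_le_const2) blast+
  thus ?thesis
    by (simp add: in_cylinder_def)
qed

lemma base_expansion_exists:
  assumes "a \<ge> 2" "\<And>i. d i < a"
  obtains x where "is_base_expansion a x d" "x \<in> {0..1}"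
proof -
  have "summable (\<lambda>i. real (d i) / real a ^ Suc i)"
  proof (rule summable_comparison_test')
    show "summable (\<lambda>i. (1 / real a) ^ i)"
      using assms(1) by (intro summable_geometric) simp
    fix i
    have "real (d i) / real a \<le> 1"
      using assms(1) assms(2)[of i] by simp
    thus "norm (real (d i) / real a ^ Suc i) \<le> (1 / real a) ^ i"
      using divide_right_mono[of "real (d i) / real a" 1 "real a ^ i"]
      by (simp add: power_one_over)
  qed
  then obtain x where x: "(\<lambda>i. real (d i) / real a ^ Suc i) sums x"
    by (auto simp: summable_def)
  hence exp: "is_base_expansion a x d"
    using assms(2) by (simp add: is_base_expansion_def)
  have "x \<ge> 0"
    by (rule sums_le[OF _ sums_zero x]) simp
  moreover have "x \<le> 1"
    using in_cylinder_expansion[OF _ exp, of 0] assms(1) by (simp add: in_cylinder_def)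
  ultimately show thesis
    using that exp by simp
qed

text \<open>Equal tails have equal values, which is a linear equation for x with rational
  coefficients and leading coefficient a^j - a^i, not zero.\<close>

lemma irrational_expansion_aperiodic:
  assumes a: "a \<ge> 2" and x: "is_base_expansion a x d" "x \<notin> \<rat>" and "i < j"
  shows "\<exists>t. d (i + t) \<noteq> d (j + t)"
proof (rule ccontr)
  assume "\<not> ?thesis"
  hence eq: "d (t + i) = d (t + j)" for t
    by (metis add.commute)
  \<comment> \<open>The number whose expansion is that of x without its first \<open>n\<close>
    digits.\<close>
  define y where "y n = (x - word_value a (map d [0..<n])) * real a ^ n" for n
  have tail: "(\<lambda>t. real (d (t + n)) / real a ^ Suc t) sums y n" for n
  proof -
    have "(\<lambda>t. real (d (t + n)) / real a ^ Suc (t + n)) sums (x - word_value a (map d [0..<n]))"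
      using sums_split_initial_segment[of "\<lambda>i. real (d i) / real a ^ Suc i" x n] x(1)
      unfolding is_base_expansion_def sum_eq_word_value by blast
    hence "(\<lambda>t. real (d (t + n)) / real a ^ Suc (t + n) * real a ^ n) sums y n"
      unfolding y_def by (rule sums_mult2)
    moreover have "real (d (t + n)) / real a ^ Suc (t + n) * real a ^ n = real (d (t + n)) / real a ^ Suc t" for t
      using a by (simp add: power_add)
    ultimately show ?thesis
      by simp
  qed
  have "y i = y j"
    using tail[of i] tail[of j] unfolding eq by (rule sums_unique2)
  hence "x * (real a ^ j - real a ^ i)
      = word_value a (map d [0..<j]) * real a ^ j - word_value a (map d [0..<i]) * real a ^ i"
    by (simp add: y_def algebra_simps)
  moreover have "real a ^ i < real a ^ j"
    using a \<open>i < j\<close> by (intro power_strict_increasing) auto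
  ultimately have "x = (word_value a (map d [0..<j]) * real a ^ j - word_value a (map d [0..<i]) * real a ^ i)
      / (real a ^ j - real a ^ i)"
    by (simp add: eq_divide_eq)
  also have "\<dots> \<in> \<rat>"
    by (intro Rats_divide Rats_diff Rats_mult word_value_rational Rats_power) auto
  finally show False
    using x(2) by simp
qed

section \<open>Standard words\<close>

text \<open>The letters 0 and 1 are digits in every base a >= 2. The last condition is the invariant
  that makes \<open>\<delta>\<close> nonzero in \<open>orbit_hits_interval\<close>.\<close>

definition standard_pair :: "nat \<Rightarrow> nat list \<Rightarrow> nat list \<Rightarrow> bool" where
  "standard_pair a u v \<longleftrightarrow> set u \<subseteq> {0, 1} \<and> set v \<subseteq> {0, 1} \<and> u \<noteq> [] \<and> v \<noteq> [] \<and>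
     almost_commute u v \<and> periodic_value a v \<noteq> periodic_value a u"

lemma standard_pair_init:
  assumes "a \<ge> 2"
  shows "standard_pair a [0] [1]"
  using assms by (simp add: standard_pair_def almost_commute_def periodic_value_def)

lemma set_word_power_subset: "set (word_power w d) \<subseteq> set w"
  by (induction d) auto

lemma standard_pair_step:
  assumes "a \<ge> 2" "standard_pair a u v"
  shows "standard_pair a (word_power u d @ v) u"
proof -
  have "length u > 0" "length v > 0"
    using assms by (auto simp: standard_pair_def)
  hence "length u + length v \<ge> 2"
    by linarith
  thus ?thesis
    using assms set_word_power_subset[of u d] almost_commute_step[of u v d]
      periodic_value_power_append_eq[of a u v d]
    unfolding standard_pair_def by auto
qed

text \<open>
  The second step has exponent 2, so that the new first word begins with \<open>u ^ d v u ^ d\<close>.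
\<close>
lemma standard_pair_stage:
  assumes a: "a \<ge> 2" and uv: "standard_pair a u v"
    and b: "b \<ge> 2" "mult_independent a b" and st: "0 \<le> s" "s < t" "t \<le> 1"
  obtains u' v' z k where "standard_pair a u' v'" "u' \<in> block_words u v" "v' \<in> block_words u v"
    "u' = u @ z" "z \<noteq> []" "\<And>x. in_cylinder a u' x \<Longrightarrow> frac (real b ^ k * x) \<in> {s<..<t}"
proof -
  obtain d k where d: "d \<ge> 1"
    and hit: "\<And>x. in_cylinder a (word_power u d @ v @ word_power u d) x \<Longrightarrow> frac (real b ^ k * x) \<in> {s<..<t}"
    using orbit_hits_interval[OF a b _ _ _ st] uv unfolding standard_pair_def by metis
  define v' where "v' = word_power u d @ v"
  define u' where "u' = word_power v' 2 @ u"
  have uv': "standard_pair a u' v'"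
    unfolding u'_def v'_def using a uv by (intro standard_pair_step)
  have blocks: "v' \<in> block_words u v" "u' \<in> block_words u v"
    unfolding u'_def v'_def
    by (intro block_words_append block_words_power block_words_left block_words_right)+
  \<comment> \<open>\<open>d \<ge> 1\<close> makes the new word begin with \<open>u\<close>, so that
    the words of successive stages extend each other.\<close>
  obtain e where e: "d = Suc e"
    using d by (cases d) auto
  have pre: "u' = (word_power u d @ v @ word_power u d) @ v @ u"
    by (simp add: u'_def v'_def numeral_2_eq_2)
  hence "u' = u @ word_power u e @ v @ word_power u d @ v @ u"
    by (simp add: e)
  moreover have "word_power u e @ v @ word_power u d @ v @ u \<noteq> []"
    using uv by (simp add: standard_pair_def)
  moreover have "frac (real b ^ k * x) \<in> {s<..<t}" if "in_cylinder a u' x" for x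
  proof -
    have "set (v @ u) \<subseteq> {..<a}"
      using a uv by (auto simp: standard_pair_def)
    thus ?thesis
      using that a hit in_cylinder_prefix[of a "v @ u"] unfolding pre by simp
  qed
  ultimately show thesis
    using that uv' blocks by metis
qed

text \<open>The code \<open>c\<close> stands for a triple (b, n, m), that is, for a b-adic interval
  of order n; codes of unsuitable triples demand nothing. One \<open>k\<close> must serve the whole
  cylinder, because x is known only in the limit.\<close>

definition hits_target :: "nat \<Rightarrow> nat \<Rightarrow> nat list \<Rightarrow> bool" where
  "hits_target a c w \<longleftrightarrow> (\<forall>b n m. c = prod_encode (b, prod_encode (n, m)) \<longrightarrow>
     b \<ge> 2 \<longrightarrow> mult_independent a b \<longrightarrow> m < b ^ n \<longrightarrow>
     (\<exists>k. \<forall>x. in_cylinder a w x \<longrightarrow> frac (real b ^ k * x) \<in> {real m / real b ^ n<..<(real m + 1) / real b ^ n}))"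

definition stage :: "nat \<Rightarrow> nat \<Rightarrow> nat list \<times> nat list \<Rightarrow> nat list \<times> nat list \<Rightarrow> bool" where
  "stage a c p q \<longleftrightarrow> fst q \<in> block_words (fst p) (snd p) \<and> snd q \<in> block_words (fst p) (snd p) \<and>
     (\<exists>z. fst q = fst p @ z \<and> z \<noteq> []) \<and> hits_target a c (fst q)"

lemma stage_exists:
  assumes a: "a \<ge> 2" and uv: "standard_pair a u v"
  shows "\<exists>q. standard_pair a (fst q) (snd q) \<and> stage a c (u, v) q"
proof -
  obtain b n m where c: "c = prod_encode (b, prod_encode (n, m))"
    by (metis prod_decode_inverse surj_pair)
  define active where "active \<longleftrightarrow> b \<ge> 2 \<and> mult_independent a b \<and> m < b ^ n"
  \<comment> \<open>A stage whose code demands nothing is run with base \<open>Suc a\<close> and the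
    interval from 0 to 1, so that the words grow at every stage.\<close>
  obtain b' s t where b': "b' \<ge> 2" "mult_independent a b'" and st: "0 \<le> s" "s < t" "t \<le> 1"
    and act: "active \<Longrightarrow> b' = b \<and> s = real m / real b ^ n \<and> t = (real m + 1) / real b ^ n"
  proof (cases active)
    case True
    hence b: "b \<ge> 2" "mult_independent a b" "m < b ^ n"
      by (auto simp: active_def)
    hence "real m + 1 \<le> real (b ^ n)"
      by linarith
    hence "(real m + 1) / real b ^ n \<le> 1" "real m / real b ^ n < (real m + 1) / real b ^ n"
      using b by (auto simp: divide_strict_right_mono)
    with b show thesis
      by (intro that[of b "real m / real b ^ n" "(real m + 1) / real b ^ n"]) auto
  next
    case False
    thus thesis
      using that[of "Suc a" 0 1] mult_independent_Suc[OF a] a by simp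
  qed
  obtain u' v' z k where q: "standard_pair a u' v'" "u' \<in> block_words u v" "v' \<in> block_words u v"
    "u' = u @ z" "z \<noteq> []" "\<And>x. in_cylinder a u' x \<Longrightarrow> frac (real b' ^ k * x) \<in> {s<..<t}"
    using standard_pair_stage[OF a uv b' st] by metis
  have "hits_target a c u'"
    unfolding hits_target_def c
  proof (intro allI impI)
    fix b1 n1 m1
    assume eq: "prod_encode (b, prod_encode (n, m)) = prod_encode (b1, prod_encode (n1, m1))"
      and b1: "2 \<le> b1" "mult_independent a b1" "m1 < b1 ^ n1"
    have "b1 = b" "n1 = n" "m1 = m"
      using eq by (simp_all add: prod_encode_eq)
    with b1 act q(6) show "\<exists>k. \<forall>x. in_cylinder a u' x \<longrightarrow>
        frac (real b1 ^ k * x) \<in> {real m1 / real b1 ^ n1<..<(real m1 + 1) / real b1 ^ n1}"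
      by (auto simp: active_def)
  qed
  thus ?thesis
    using q by (intro exI[of _ "(u', v')"]) (auto simp: stage_def)
qed

theorem corollary1p4:
  fixes a :: nat
  assumes "a \<ge> 2"
  shows "\<exists>x::real. x \<in> {0..1} \<and>
           (\<forall>n\<ge>1. base_complexity a n x = n + 1) \<and>
           (\<forall>b\<ge>2. mult_independent a b \<longrightarrow> (\<forall>n\<ge>1. base_complexity b n x = b ^ n))"
proof -
  have "\<exists>f. \<forall>c. standard_pair a (fst (f c)) (snd (f c)) \<and> stage a c (f c) (f (Suc c))"
  proof (rule dependent_nat_choice)
    show "\<exists>p. standard_pair a (fst p) (snd p)"
      using standard_pair_init[OF assms] by (metis fst_conv snd_conv)
    show "\<exists>q. standard_pair a (fst q) (snd q) \<and> stage a c p q"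
      if "standard_pair a (fst p) (snd p)" for p c
      using stage_exists[OF assms that] by simp
  qed
  then obtain f where f: "\<And>c. standard_pair a (fst (f c)) (snd (f c))" "\<And>c. stage a c (f c) (f (Suc c))"
    by blast
  define U where "U c = fst (f c)" for c
  define V where "V c = snd (f c)" for c
  have pair: "standard_pair a (U c) (V c)" for c
    using f by (simp add: U_def V_def)
  have blocks1: "U (Suc c) \<in> block_words (U c) (V c)" "V (Suc c) \<in> block_words (U c) (V c)"
    and ext1: "\<exists>z. U (Suc c) = U c @ z \<and> z \<noteq> []" and hit: "hits_target a c (U (Suc c))" for c
    using f(2)[of c] by (auto simp: stage_def U_def V_def)
  have blocks: "U (c + k) \<in> block_words (U c) (V c) \<and> V (c + k) \<in> block_words (U c) (V c)" for c k
  proof (induction k)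
    case (Suc k)
    thus ?case
      using blocks1[of "c + k"] block_words_trans by simp
  qed (simp add: block_words_left block_words_right)
  have ext: "\<exists>z. U (c + k) = U c @ z" for c k
  proof (induction k)
    case (Suc k)
    thus ?case
      using ext1[of "c + k"] by auto
  qed simp
  have len: "length (U c) > c" for c
  proof (induction c)
    case 0
    thus ?case using pair[of 0] by (simp add: standard_pair_def)
  next
    case (Suc c)
    obtain z where "U (Suc c) = U c @ z" "z \<noteq> []"
      using ext1 by blast
    hence "length (U (Suc c)) = length (U c) + length z" "length z > 0"
      by simp_all
    with Suc show ?case
      by linarith
  qed
  \<comment> \<open>\<open>U i\<close> has more than \<open>i\<close> letters and is a prefix of all
    later words, so letter \<open>i\<close> is settled at stage \<open>i\<close>.\<close>
  define d where "d i = U i ! i" for i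
  have d_nth: "d i = U c ! i" if "i < length (U c)" for i c
  proof -
    obtain z z' where "U (c + i) = U c @ z" "U (i + c) = U i @ z'"
      using ext by meson
    thus ?thesis
      using that len[of i] by (metis add.commute d_def nth_append_left)
  qed
  have prefix: "map d [0..<length (U c)] = U c" for c
    by (rule nth_equalityI) (auto simp: d_nth)
  have d01: "d i \<in> {0, 1}" for i
    using pair[of i] len[of i] nth_mem[of i "U i"] unfolding d_def standard_pair_def by blast
  have d_less: "d i < a" for i
    using d01[of i] assms by auto
  obtain x where x: "is_base_expansion a x d" "x \<in> {0..1}"
    using base_expansion_exists[OF assms d_less] .
  have hits: "\<exists>k. frac (real b ^ k * x) \<in> {real m / real b ^ n<..<(real m + 1) / real b ^ n}"
    if "b \<ge> 2" "mult_independent a b" "m < b ^ n" for b n m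
  proof -
    define c where "c = prod_encode (b, prod_encode (n, m))"
    have "in_cylinder a (U (Suc c)) x"
      using in_cylinder_expansion[OF _ x(1), of "length (U (Suc c))"] assms by (simp add: prefix)
    thus ?thesis
      using hit[of c] that unfolding hits_target_def c_def by blast
  qed
  \<comment> \<open>The targets \<open>m = 0\<close> in base \<open>Suc a\<close> give positive
    fractional parts below every (a + 1)^-n. Irrationality then identifies \<open>d\<close> with
    \<open>base_digit a x\<close>.\<close>
  have irr: "x \<notin> \<rat>"
  proof (rule irrational_if_small_fracs)
    show "\<exists>k. frac (real (Suc a) ^ k * x) \<in> {0<..<1 / real (Suc a) ^ n}" for n
      using hits[of "Suc a" 0 n] assms mult_independent_Suc by simp
  qed (use assms in simp)
  have digits: "base_digit a x = d"
    using is_base_expansion_iff_base_digit[OF assms x(2) irr] x(1) by simp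
  have "card (windows n d) = Suc n" for n
  proof (rule card_windows_eq)
    have "range d \<subseteq> {0, 1}"
      unfolding image_subset_iff using d01 by blast
    thus "finite (range d)"
      by (rule finite_subset) simp
    show "\<exists>t. d (i + t) \<noteq> d (j + t)" if "i < j" for i j
      using irrational_expansion_aperiodic[OF assms x(1) irr that] .
    fix n
    \<comment> \<open>Late stages give the upper bound at arbitrarily large lengths:
      \<open>U (n + i)\<close> is both a prefix of \<open>d\<close> and a product of the blocks of
      stage \<open>n\<close>.\<close>
    define m where "m = length (U n) + length (V n) - 1"
    have "m \<ge> n"
      using len[of n] by (simp add: m_def)
    moreover have "card (windows m d) \<le> Suc m"
    proof (rule card_windows_le[OF _ _ _ _ m_def])
      fix i
      have "length (U (n + i)) \<ge> i"
        using len[of "n + i"] by simp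
      thus "\<exists>w\<in>block_words (U n) (V n). i \<le> length w \<and> map d [0..<length w] = w"
        using blocks[of n i] prefix by blast
    qed (use pair[of n] in \<open>auto simp: standard_pair_def\<close>)
    ultimately show "\<exists>m\<ge>n. card (windows m d) \<le> Suc m"
      by blast
  qed
  hence "base_complexity a n x = n + 1" for n
    by (simp add: base_complexity_def base_words_eq_windows[OF assms] digits)
  moreover have "base_complexity b n x = b ^ n" if "b \<ge> 2" "mult_independent a b" for b n
    using that x(2) hits by (intro base_complexity_maximal) auto
  ultimately show ?thesis
    using x(2) by blast
qed

end
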